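(* Let $G$ be a finite group and let $Max_G=\{x_1,\dots,x_m\}$ be an essential cyclic set of $G$ with $icn(G)=0$. Then: $rc(\Gamma_G^e)=1$ if and only if $G$ is cyclic; $rc(\Gamma_G^e)=2$ if and only if $G$ has an awning and $G$ is not cyclic; $rc(\Gamma_G^e)=3$ if and only if $G$ does not have an awning.
   Context: Let $G$ be a finite group with identity $e$. The enhanced power graph $\Gamma_G^e$ has vertex set $G$, two distinct vertices $x,y$ being adjacent iff $x,y\in\langle z\rangle$ for some $z\in G$. For a connected graph $\Gamma$, an edge-colouring $\zeta:E(\Gamma)\to\{1,\dots,k\}$ (not necessarily proper) is a rainbow $k$-colouring if every pair of distinct vertices is joined by a path whose edges have pairwise distinct colours; $rc(\Gamma)$ is the minimum such $k$. An essential cyclic set $Max_G=\{x_1,\dots,x_m\}$ is a set of elements of $G$ such that $\langle x_1\rangle,\dots,\langle x_m\rangle$ are pairwise distinct and are exactly the maximal cyclic subgroups of $G$. The independence cyclic set is $ics(G)=\{x_i\in Max_G:\langle x_i\rangle\cap\langle x_j\rangle=\{e\}\text{ for all }j\neq i\}$ and $icn(G)=|ics(G)|$. Awning: given an ordering $x_1,\dots,x_m$ of $Max_G$, an awning is a family of indexed sets $H_1,\dots,H_{m-1}$, where $H_i=\{h_{i,i+1},\dots,h_{i,m}\}\subseteq\langle x_i\rangle$ is partitioned as $H_i=A_i\,\dot\cup\,B_i$, such that (1) $h_{i,j}\in\langle x_i\rangle\cap\langle x_j\rangle$ for all $i<j$; (2) whenever $i<j$, $2\le j\le m-1$, $s\in\{j+1,\dots,m\}$,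 $r\in\{i+1,\dots,m\}$ and $h_{j,s}=h_{i,r}$: (a) if $r=j$ and $h_{i,r}\in A_i$ then $h_{j,s}\in B_j$; (b) if $r=j$ and $h_{i,r}\in B_i$ then $h_{j,s}\in A_j$; (c) if $r=s>j$ and $h_{i,r}\in A_i$ then $h_{j,r}\in A_j$; (d) if $r=s>j$ and $h_{i,r}\in B_i$ then $h_{j,r}\in B_j$. $G$ has an awning if an awning exists for some ordering of $Max_G$. *)

theory Defs
  imports "HOL-Algebra.Algebra"
begin

text \<open>
  A simple graph is a vertex set \<open>V\<close> together with a set \<open>E\<close> of two-element subsets of \<open>V\<close>.
\<close>

fun path_edges :: "'a list \<Rightarrow> 'a set list" where
  "path_edges (x # y # p) = {x, y} # path_edges (y # p)"
| "path_edges _ = []"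

definition graph_path :: "'a set \<Rightarrow> 'a set set \<Rightarrow> 'a \<Rightarrow> 'a list \<Rightarrow> 'a \<Rightarrow> bool" where
  "graph_path V E x p y \<longleftrightarrow>
     p \<noteq> [] \<and> hd p = x \<and> last p = y \<and> distinct p \<and> set p \<subseteq> V \<and> set (path_edges p) \<subseteq> E"

definition rainbow_colouring :: "'a set \<Rightarrow> 'a set set \<Rightarrow> nat \<Rightarrow> ('a set \<Rightarrow> nat) \<Rightarrow> bool" where
  "rainbow_colouring V E k \<zeta> \<longleftrightarrow>
     (\<forall>e\<in>E. \<zeta> e \<in> {1..k}) \<and>
     (\<forall>x\<in>V. \<forall>y\<in>V. x \<noteq> y \<longrightarrow>
        (\<exists>p. graph_path V E x p y \<and> distinct (map \<zeta> (path_edges p))))"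

text \<open>
  Only meaningful for finite connected graphs, where some rainbow colouring exists
  (colour all edges differently).
\<close>

definition rc :: "'a set \<Rightarrow> 'a set set \<Rightarrow> nat" where
  "rc V E = (LEAST k. \<exists>\<zeta>. rainbow_colouring V E k \<zeta>)"

text \<open>The edge set of the enhanced power graph, whose vertex set is \<^term>\<open>carrier G\<close>.\<close>

definition enhanced_power_edges :: "('a, 'b) monoid_scheme \<Rightarrow> 'a set set" where
  "enhanced_power_edges G =
     {{x, y} | x y. x \<in> carrier G \<and> y \<in> carrier G \<and> x \<noteq> y \<and>
        (\<exists>z\<in>carrier G. x \<in> generate G {z} \<and> y \<in> generate G {z})}"

definition cyclic_subgroups :: "('a, 'b) monoid_scheme \<Rightarrow> 'a set set" where
  "cyclic_subgroups G = {generate G {z} | z. z \<in> carrier G}"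

definition maximal_cyclic_subgroups :: "('a, 'b) monoid_scheme \<Rightarrow> 'a set set" where
  "maximal_cyclic_subgroups G =
     {C \<in> cyclic_subgroups G. \<forall>D\<in>cyclic_subgroups G. C \<subseteq> D \<longrightarrow> C = D}"

definition essential_cyclic_set :: "('a, 'b) monoid_scheme \<Rightarrow> 'a set \<Rightarrow> bool" where
  "essential_cyclic_set G M \<longleftrightarrow>
     M \<subseteq> carrier G \<and>
     inj_on (\<lambda>x. generate G {x}) M \<and>
     (\<lambda>x. generate G {x}) ` M = maximal_cyclic_subgroups G"

definition ics :: "('a, 'b) monoid_scheme \<Rightarrow> 'a set \<Rightarrow> 'a set" where
  "ics G M = {x \<in> M. \<forall>y\<in>M. y \<noteq> x \<longrightarrow> generate G {x} \<inter> generate G {y} = {\<one>\<^bsub>G\<^esub>}}"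

definition icn :: "('a, 'b) monoid_scheme \<Rightarrow> 'a set \<Rightarrow> nat" where
  "icn G M = card (ics G M)"

text \<open>
  Here \<open>x 1, \<dots>, x m\<close> is the ordering and \<open>H\<^sub>i\<close> is the set \<^term>\<open>h i ` {i+1..m}\<close>.  The parts \<open>A i\<close>
  and \<open>B i\<close> are sets of group elements, so equal entries \<open>h i r = h i s\<close> lie in the same part;
  a part may be empty.
\<close>

definition awning ::
  "('a, 'b) monoid_scheme \<Rightarrow> nat \<Rightarrow> (nat \<Rightarrow> 'a) \<Rightarrow> (nat \<Rightarrow> nat \<Rightarrow> 'a) \<Rightarrow>
   (nat \<Rightarrow> 'a set) \<Rightarrow> (nat \<Rightarrow> 'a set) \<Rightarrow> bool" where
  "awning G m x h A B \<longleftrightarrow>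
     (\<forall>i\<in>{1..m-1}. h i ` {i+1..m} \<subseteq> generate G {x i} \<and>
        h i ` {i+1..m} = A i \<union> B i \<and> A i \<inter> B i = {}) \<and>
     (\<forall>i\<in>{1..m-1}. \<forall>j\<in>{i+1..m}. h i j \<in> generate G {x i} \<inter> generate G {x j}) \<and>
     (\<forall>i j r s. 1 \<le> i \<and> i < j \<and> j \<in> {2..m-1} \<and> s \<in> {j+1..m} \<and> r \<in> {i+1..m} \<and>
        h j s = h i r \<longrightarrow>
        (r = j \<and> h i r \<in> A i \<longrightarrow> h j s \<in> B j) \<and>
        (r = j \<and> h i r \<in> B i \<longrightarrow> h j s \<in> A j) \<and>
        (r = s \<and> s > j \<and> h i r \<in> A i \<longrightarrow> h j r \<in> A j) \<and>
        (r = s \<and> s > j \<and> h i r \<in> B i \<longrightarrow> h j r \<in> B j))"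

definition has_awning :: "('a, 'b) monoid_scheme \<Rightarrow> 'a set \<Rightarrow> bool" where
  "has_awning G M \<longleftrightarrow>
     (\<exists>x h A B. bij_betw x {1..card M} M \<and> awning G (card M) x h A B)"

end

theory Submission imports Defs begin

text \<open>
  The hypothesis \<open>icn G M = 0\<close> makes \<open>M\<close> have at least two elements; distinct elements of \<open>M\<close> are
  not adjacent, so \<open>G\<close> is not cyclic and at least two colours are needed.  It also says that
  the graph without the identity \<open>\<one>\<close> has no isolated vertex, so its vertices
  split into two classes such that each vertex has a neighbour in the other class.  Colour the edge
  from \<open>\<one>\<close> to \<open>y\<close> by the class of \<open>y\<close> and every other edge by a third colour: two vertices of the
  same class are joined by a rainbow path \<open>y, h, \<one>, z\<close>.  So three colours suffice.

  Two colours suffice iff the pairs \<open>(k, g)\<close> with \<open>g\<close> in the subgroup \<open>\<langle>x\<^sub>k\<rangle>\<close> can be 2-coloured so that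
  any \<open>i < j\<close> have a common element \<open>h\<^sub>i\<^sub>j\<close> for which \<open>(i, h\<^sub>i\<^sub>j)\<close> and \<open>(j, h\<^sub>i\<^sub>j)\<close> get different colours,
  and an awning encodes such a colouring.  To extend it to edges between arbitrary vertices, let
  \<open>\<iota> u\<close> be the least \<open>k\<close> with \<open>u \<in> \<langle>x\<^sub>k\<rangle>\<close>, and give the edge \<open>{u, v}\<close> with \<open>v\<close> in the
  subgroup of index \<open>\<iota> u\<close> the colour of \<open>(\<iota> u, v)\<close>.  If also \<open>u\<close> lies in the subgroup of index
  \<open>\<iota> v\<close>, then \<open>\<iota> u = \<iota> v\<close>, and the two demands agree once the colouring is normalised, for each
  element \<open>g\<close> separately, such that all the pairs \<open>(\<iota> g, g)\<close> have the same colour.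
\<close>

section \<open>Splitting a graph without isolated vertices\<close>

text \<open>A maximal independent set serves as \<open>I\<close>: a vertex outside it has a
  neighbour inside by maximality, and a vertex inside has all its other neighbours outside.\<close>

lemma ex_opposite_classes:
  assumes "finite V"
    and sym: "\<And>u v. adj u v \<Longrightarrow> adj v u"
    and nbr: "\<And>v. v \<in> V \<Longrightarrow> \<exists>u\<in>V. u \<noteq> v \<and> adj v u"
  shows "\<exists>I\<subseteq>V. \<forall>v\<in>V. \<exists>u\<in>V. adj v u \<and> (u \<in> I) \<noteq> (v \<in> I)"
proof -
  let ?F = "{I. I \<subseteq> V \<and> (\<forall>u\<in>I. \<forall>v\<in>I. u \<noteq> v \<longrightarrow> \<not> adj u v)}"
  have "finite ?F"
    by (rule finite_subset[of _ "Pow V"]) (use assms(1) in auto)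
  moreover have "{} \<in> ?F" by simp
  ultimately obtain I where I: "I \<in> ?F" and max: "\<And>J. J \<in> ?F \<Longrightarrow> I \<subseteq> J \<Longrightarrow> I = J"
    using finite_has_maximal[of ?F] by (metis (no_types, lifting) empty_iff)
  have IV: "I \<subseteq> V" and indep: "\<And>u v. u \<in> I \<Longrightarrow> v \<in> I \<Longrightarrow> u \<noteq> v \<Longrightarrow> \<not> adj u v"
    using I by auto
  have "\<exists>u\<in>V. adj v u \<and> (u \<in> I) \<noteq> (v \<in> I)" if v: "v \<in> V" for v
  proof (cases "v \<in> I")
    case True
    moreover obtain u where "u \<in> V" "u \<noteq> v" "adj v u" using nbr[OF v] by blast
    ultimately show ?thesis using indep[of v u] by auto
  next
    case False
    then have "insert v I \<notin> ?F" using max[of "insert v I"] by auto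
    then obtain u where "u \<in> I" "adj v u" using v IV indep sym by auto
    then show ?thesis using False IV by auto
  qed
  then show ?thesis using IV by auto
qed

section \<open>From an awning to a colouring of index-element pairs\<close>

lemma awning_two_colouring:
  assumes "awning G m x h A B"
  obtains c :: "nat \<Rightarrow> 'a \<Rightarrow> bool"
  where "\<And>i j. 1 \<le> i \<Longrightarrow> i < j \<Longrightarrow> j \<le> m \<Longrightarrow> c i (h i j) \<noteq> c j (h i j)"
proof
  \<comment> \<open>If \<open>g\<close> is an entry of row \<open>k\<close>, the parts decide.
    Otherwise, as always for \<open>k = m\<close>, which has no row, only earlier rows with
    \<open>g\<close> in column \<open>k\<close> constrain the pair, and it takes the colour opposite
    to theirs.\<close>
  define c where "c k g = (if k < m \<and> g \<in> h k ` {k+1..m} then g \<in> A k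
      else \<not> (\<exists>i<k. 1 \<le> i \<and> h i k = g \<and> g \<in> A i))" for k g
  fix i j :: nat
  assume ij: "1 \<le> i" "i < j" "j \<le> m"
  have parts: "h k ` {k+1..m} = A k \<union> B k" "A k \<inter> B k = {}" if "1 \<le> k" "k < m" for k
    using assms that unfolding awning_def by auto
  have clash: "(k < l \<and> h l s = h k r \<longrightarrow>
        (r = l \<and> h k r \<in> A k \<longrightarrow> h l s \<in> B l) \<and>
        (r = l \<and> h k r \<in> B k \<longrightarrow> h l s \<in> A l) \<and>
        (r = s \<and> h k r \<in> A k \<longrightarrow> h l r \<in> A l) \<and>
        (r = s \<and> h k r \<in> B k \<longrightarrow> h l r \<in> B l))"
    if "1 \<le> k" "l < s" "s \<le> m" "k < r" "r \<le> m" for k l r s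
  proof
    assume *: "k < l \<and> h l s = h k r"
    have "1 \<le> k \<and> k < l \<and> l \<in> {2..m-1} \<and> s \<in> {l+1..m} \<and> r \<in> {k+1..m} \<and> h l s = h k r"
      using * that by auto
    then show "(r = l \<and> h k r \<in> A k \<longrightarrow> h l s \<in> B l) \<and>
        (r = l \<and> h k r \<in> B k \<longrightarrow> h l s \<in> A l) \<and>
        (r = s \<and> h k r \<in> A k \<longrightarrow> h l r \<in> A l) \<and>
        (r = s \<and> h k r \<in> B k \<longrightarrow> h l r \<in> B l)"
      using assms that unfolding awning_def by (metis (no_types, lifting))
  qed
  have i: "h i j \<in> h i ` {i+1..m}" "i < m" using ij by auto
  then have ci: "c i (h i j) \<longleftrightarrow> h i j \<in> A i" unfolding c_def by simp
  have AB: "h i j \<in> A i \<longleftrightarrow> h i j \<notin> B i" using parts[of i] i ij by blast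
  show "c i (h i j) \<noteq> c j (h i j)"
  proof (cases "j < m \<and> h i j \<in> h j ` {j+1..m}")
    case True
    then obtain s where s: "j < s" "s \<le> m" "h j s = h i j"
      by (fastforce simp: Suc_le_eq)
    have "h i j \<in> A j \<longleftrightarrow> h i j \<notin> B j" using parts[of j] True ij by auto
    then have "h i j \<in> A j \<longleftrightarrow> h i j \<notin> A i"
      using clash[of i j s j] s ij AB by metis
    then show ?thesis using ci True unfolding c_def by simp
  next
    case False
    \<comment> \<open>Rows sharing an entry in column \<open>j\<close> put it on the same side, so
      the existential in \<open>c\<close> may be tested on row \<open>i\<close> alone.\<close>
    have "k = i \<or> h i j \<in> A i" if k: "k < j" "1 \<le> k" "h k j = h i j" "h i j \<in> A k" for k
    proof (rule ccontr)
      assume neg: "\<not> ?thesis"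
      then have iB: "h i j \<in> B i" using AB by blast
      have "h i j \<notin> B k" using parts[of k] k ij by auto
      then show False
        using clash[of i k j j] clash[of k i j j] k neg iB ij by (metis linorder_neqE_nat)
    qed
    then have "(\<exists>k<j. 1 \<le> k \<and> h k j = h i j \<and> h i j \<in> A k) \<longleftrightarrow> h i j \<in> A i"
      using ij by blast
    then show ?thesis using ci False unfolding c_def by auto
  qed
qed

section \<open>Rainbow paths with few edges\<close>

lemma graph_path_edge:
  assumes "u \<in> V" "v \<in> V" "u \<noteq> v" "{u, v} \<in> E"
  shows "\<exists>p. graph_path V E u p v \<and> distinct (map \<zeta> (path_edges p))"
  by (rule exI[of _ "[u, v]"]) (use assms in \<open>auto simp: graph_path_def\<close>)

lemma graph_path_two_edges:
  assumes "u \<in> V" "h \<in> V" "v \<in> V" "u \<noteq> v" "u \<noteq> h" "h \<noteq> v"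
    and "{u, h} \<in> E" "{h, v} \<in> E" "\<zeta> {u, h} \<noteq> \<zeta> {h, v}"
  shows "\<exists>p. graph_path V E u p v \<and> distinct (map \<zeta> (path_edges p))"
  by (rule exI[of _ "[u, h, v]"]) (use assms in \<open>auto simp: graph_path_def\<close>)

lemma rainbow_path_length:
  assumes "rainbow_colouring V E k \<zeta>" "graph_path V E u p v" "distinct (map \<zeta> (path_edges p))"
  shows "length (path_edges p) \<le> k"
proof -
  have "set (map \<zeta> (path_edges p)) \<subseteq> {1..k}"
    using assms unfolding rainbow_colouring_def graph_path_def by auto
  then have "card (set (map \<zeta> (path_edges p))) \<le> k"
    using card_mono[of "{1..k}"] by fastforce
  then show ?thesis using distinct_card[OF assms(3)] by simp
qed

text \<open>Non-adjacency forces at least two edges, and distinct colours allow at most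
  \<open>k\<close> of them. Assuming only \<open>k \<le> 2\<close> lets the conclusion
  \<open>k = 2\<close> serve as a lower bound on the number of colours.\<close>

lemma rainbow_two_colouring_midpoint:
  assumes col: "rainbow_colouring V E k \<zeta>" and "k \<le> 2"
    and "u \<in> V" "v \<in> V" "u \<noteq> v" "{u, v} \<notin> E"
  obtains h where "k = 2" "{u, h} \<in> E" "{h, v} \<in> E" "\<zeta> {u, h} \<noteq> \<zeta> {h, v}"
proof -
  obtain p where p: "graph_path V E u p v" "distinct (map \<zeta> (path_edges p))"
    using col assms unfolding rainbow_colouring_def by blast
  have len: "length (path_edges p) \<le> k" by (rule rainbow_path_length[OF col p])
  obtain q where q: "p = u # q" "last p = v" "set (path_edges p) \<subseteq> E"
    using p(1) unfolding graph_path_def by (cases p) auto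
  obtain h q' where h: "q = h # q'" using q \<open>u \<noteq> v\<close> by (cases q) auto
  have "q' \<noteq> []" using q h assms by auto
  then obtain w r where w: "q' = w # r" by (cases q') auto
  have "r = []"
  proof (cases r)
    case (Cons a b)
    then have "length (path_edges p) \<ge> 3" using q h w by simp
    then show ?thesis using len \<open>k \<le> 2\<close> by simp
  qed simp
  then have "p = [u, h, v]" using q h w by simp
  then show ?thesis using that[of h] p len \<open>k \<le> 2\<close> q by auto
qed

section \<open>Maximal cyclic subgroups and adjacency\<close>

locale essential_cyclic = group G for G (structure) +
  fixes M
  assumes finite_carrier: "finite (carrier G)"
    and essential: "essential_cyclic_set G M"
begin

lemma M_carrier: "x \<in> M \<Longrightarrow> x \<in> carrier G"
  using essential unfolding essential_cyclic_set_def by blast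

lemma self_in_generate: "x \<in> generate G {x}"
  by (rule generate.incl) simp

lemma generate_carrier: "x \<in> carrier G \<Longrightarrow> g \<in> generate G {x} \<Longrightarrow> g \<in> carrier G"
  using generate_incl[of "{x}"] by auto

lemma generate_mono_elt:
  "x \<in> carrier G \<Longrightarrow> y \<in> generate G {x} \<Longrightarrow> generate G {y} \<subseteq> generate G {x}"
  by (rule generate_subgroup_incl) (auto intro: generate_is_subgroup)

lemma M_generate_maximal:
  assumes "x \<in> M" "z \<in> carrier G" "x \<in> generate G {z}"
  shows "generate G {x} = generate G {z}"
proof -
  have "generate G {x} \<in> maximal_cyclic_subgroups G"
    using assms(1) essential unfolding essential_cyclic_set_def by blast
  moreover have "generate G {z} \<in> cyclic_subgroups G"
    using assms(2) unfolding cyclic_subgroups_def by blast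
  ultimately show ?thesis
    using generate_mono_elt[OF assms(2,3)] unfolding maximal_cyclic_subgroups_def by blast
qed

lemma M_generate_eq: "x \<in> M \<Longrightarrow> y \<in> M \<Longrightarrow> x \<in> generate G {y} \<Longrightarrow> x = y"
  using M_generate_maximal[of x y] M_carrier essential
  unfolding essential_cyclic_set_def inj_on_def by blast

lemma generate_subset_M:
  assumes "z \<in> carrier G"
  obtains x where "x \<in> M" "generate G {z} \<subseteq> generate G {x}"
proof -
  have "finite (cyclic_subgroups G)"
    unfolding cyclic_subgroups_def using finite_carrier by simp
  moreover have "generate G {z} \<in> cyclic_subgroups G"
    using assms unfolding cyclic_subgroups_def by blast
  ultimately obtain D where "D \<in> cyclic_subgroups G" "generate G {z} \<subseteq> D"
      "\<And>D'. D' \<in> cyclic_subgroups G \<Longrightarrow> D \<subseteq> D' \<Longrightarrow> D = D'"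
    by (metis finite_has_maximal2)
  then have "D \<in> maximal_cyclic_subgroups G" unfolding maximal_cyclic_subgroups_def by blast
  then obtain x where "x \<in> M" "D = generate G {x}"
    using essential unfolding essential_cyclic_set_def by blast
  then show ?thesis using that \<open>generate G {z} \<subseteq> D\<close> by blast
qed

lemma in_some_generate:
  assumes "y \<in> carrier G"
  obtains x where "x \<in> M" "y \<in> generate G {x}"
  using generate_subset_M[OF assms] self_in_generate by blast

abbreviation edges :: "'a set set" where "edges \<equiv> enhanced_power_edges G"

text \<open>Any common cyclic subgroup can be enlarged to a maximal one, so the witness may be taken
  in \<open>M\<close>.\<close>

lemma edge_iff:
  "{u, v} \<in> edges \<longleftrightarrow> u \<noteq> v \<and> (\<exists>x\<in>M. u \<in> generate G {x} \<and> v \<in> generate G {x})"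
proof
  assume "{u, v} \<in> edges"
  then obtain z where "u \<noteq> v" "z \<in> carrier G" "u \<in> generate G {z}" "v \<in> generate G {z}"
    unfolding enhanced_power_edges_def by (auto simp: doubleton_eq_iff)
  moreover obtain x where "x \<in> M" "generate G {z} \<subseteq> generate G {x}"
    using generate_subset_M[OF \<open>z \<in> carrier G\<close>] .
  ultimately show "u \<noteq> v \<and> (\<exists>x\<in>M. u \<in> generate G {x} \<and> v \<in> generate G {x})" by blast
next
  assume "u \<noteq> v \<and> (\<exists>x\<in>M. u \<in> generate G {x} \<and> v \<in> generate G {x})"
  then show "{u, v} \<in> edges"
    unfolding enhanced_power_edges_def using M_carrier generate_carrier by blast
qed

text \<open>A member of \<open>M\<close> lies in no maximal cyclic subgroup but its own, so its
  neighbours are confined to that one.\<close>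

lemma edge_M_iff: "x \<in> M \<Longrightarrow> {x, v} \<in> edges \<longleftrightarrow> x \<noteq> v \<and> v \<in> generate G {x}"
  using M_generate_eq self_in_generate edge_iff by blast

lemma M_not_edge: "x \<in> M \<Longrightarrow> y \<in> M \<Longrightarrow> {x, y} \<notin> edges"
  using edge_M_iff M_generate_eq by blast

lemma one_edge: "y \<in> carrier G \<Longrightarrow> y \<noteq> \<one> \<Longrightarrow> {\<one>, y} \<in> edges"
  unfolding edge_iff using in_some_generate[of y] generate.one by (metis (no_types))

lemma finite_M: "finite M"
  by (rule finite_subset[OF _ finite_carrier]) (use M_carrier in auto)

section \<open>Awnings and rainbow 2-colourings\<close>

text \<open>The midpoint of a rainbow path from \<open>x i\<close> to \<open>x j\<close> lies in
  both subgroups and becomes the entry \<open>h i j\<close>; the parts record the colour of the edge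
  from \<open>x i\<close> to the entry.\<close>

lemma rainbow_colouring_awning:
  assumes col: "rainbow_colouring (carrier G) edges 2 \<zeta>"
  shows "has_awning G M"
proof -
  obtain x where x: "bij_betw x {1..card M} M"
    using ex_bij_betw_nat_finite_1[OF finite_M] by blast
  have xM: "x i \<in> M" if "i \<in> {1..card M}" for i
    using bij_betwE[OF x] that by blast
  have "\<exists>h. {x i, h} \<in> edges \<and> {h, x j} \<in> edges \<and> \<zeta> {x i, h} \<noteq> \<zeta> {h, x j}"
    if "1 \<le> i" "i < j" "j \<le> card M" for i j
  proof -
    have "x i \<noteq> x j"
      using inj_onD[OF bij_betw_imp_inj_on[OF x], of i j] that by auto
    moreover have "x i \<in> M" "x j \<in> M" using xM that by auto
    ultimately obtain g
      where "{x i, g} \<in> edges" "{g, x j} \<in> edges" "\<zeta> {x i, g} \<noteq> \<zeta> {g, x j}"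
      by (metis rainbow_two_colouring_midpoint[OF col order_refl] M_carrier M_not_edge)
    then show ?thesis by blast
  qed
  then obtain h where h: "\<And>i j. 1 \<le> i \<Longrightarrow> i < j \<Longrightarrow> j \<le> card M \<Longrightarrow>
      {x i, h i j} \<in> edges \<and> {h i j, x j} \<in> edges \<and> \<zeta> {x i, h i j} \<noteq> \<zeta> {h i j, x j}"
    by metis
  have mem: "h i j \<in> generate G {x i}" "h i j \<in> generate G {x j}"
    if "1 \<le> i" "i < j" "j \<le> card M" for i j
    using h[OF that] that edge_M_iff[OF xM[of i]] edge_M_iff[OF xM[of j]]
    by (auto simp: insert_commute)
  have opp: "\<zeta> {x i, h i j} = 1 \<longleftrightarrow> \<zeta> {x j, h i j} \<noteq> 1"
    if "1 \<le> i" "i < j" "j \<le> card M" for i j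
  proof -
    have "\<zeta> {x i, h i j} \<in> {1..2}" "\<zeta> {h i j, x j} \<in> {1..2}"
      using h[OF that] col unfolding rainbow_colouring_def by blast+
    then show ?thesis using h[OF that] by (auto simp: insert_commute)
  qed
  define A where "A i = {g \<in> h i ` {i+1..card M}. \<zeta> {x i, g} = 1}" for i
  define B where "B i = {g \<in> h i ` {i+1..card M}. \<zeta> {x i, g} \<noteq> 1}" for i
  have part: "h i j \<in> A i \<longleftrightarrow> \<zeta> {x i, h i j} = 1" "h i j \<in> B i \<longleftrightarrow> \<zeta> {x i, h i j} \<noteq> 1"
    if "i < j" "j \<le> card M" for i j
    using that unfolding A_def B_def by auto
  have "awning G (card M) x h A B"
    unfolding awning_def
  proof (intro conjI ballI allI impI, goal_cases)
    case (1 i)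
    then show ?case using mem by auto
  next
    case (2 i)
    then show ?case unfolding A_def B_def by auto
  next
    case (3 i)
    then show ?case unfolding A_def B_def by auto
  next
    case (4 i j)
    then show ?case using mem by auto
  next
    case (5 i j r s)
    \<comment> \<open>The shared entry is the midpoint between \<open>x i\<close> and
      \<open>x j\<close>, where the colour changes.\<close>
    then show ?case using opp[of i j] part[of i r] part[of j s] by auto
  next
    case (6 i j r s)
    then show ?case using opp[of i j] part[of i r] part[of j s] by auto
  next
    case (7 i j r s)
    \<comment> \<open>The edges from the shared entry to \<open>x i\<close> and to
      \<open>x j\<close> both differ in colour from the one to \<open>x s\<close>; with two colours
      they agree.\<close>
    then show ?case using opp[of i s] opp[of j s] part[of i r] part[of j s] by auto
  next
    case (8 i j r s)
    then show ?case using opp[of i s] opp[of j s] part[of i r] part[of j s] by auto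
  qed
  then show ?thesis unfolding has_awning_def using x by blast
qed

lemma awning_rainbow_colouring:
  assumes "has_awning G M"
  shows "\<exists>\<zeta>. rainbow_colouring (carrier G) edges 2 \<zeta>"
proof -
  obtain x h A B where x: "bij_betw x {1..card M} M" and aw: "awning G (card M) x h A B"
    using assms unfolding has_awning_def by blast
  obtain c :: "nat \<Rightarrow> 'a \<Rightarrow> bool"
    where c: "\<And>i j. 1 \<le> i \<Longrightarrow> i < j \<Longrightarrow> j \<le> card M \<Longrightarrow> c i (h i j) \<noteq> c j (h i j)"
    using awning_two_colouring[OF aw] by blast
  let ?C = "\<lambda>k. generate G {x k}"
  have xM: "x i \<in> M" if "i \<in> {1..card M}" for i
    using bij_betwE[OF x] that by blast
  have hC: "h i j \<in> ?C i" "h i j \<in> ?C j" if "1 \<le> i" "i < j" "j \<le> card M" for i j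
    using aw that unfolding awning_def by auto
  define \<iota> where "\<iota> y = (LEAST k. k \<in> {1..card M} \<and> y \<in> ?C k)" for y
  have iota: "\<iota> y \<in> {1..card M} \<and> y \<in> ?C (\<iota> y)" if y: "y \<in> carrier G" for y
  proof -
    obtain z where z: "z \<in> M" "y \<in> generate G {z}" using in_some_generate[OF y] .
    then obtain k where "k \<in> {1..card M} \<and> y \<in> ?C k"
      using bij_betw_imp_surj_on[OF x] by (metis imageE)
    then show ?thesis unfolding \<iota>_def by (rule LeastI)
  qed
  have iota_le: "\<iota> y \<le> k" if "k \<in> {1..card M}" "y \<in> ?C k" for y k
    unfolding \<iota>_def using that by (intro Least_le) simp
  \<comment> \<open>This is the normalisation: \<open>d (\<iota> g) g\<close> always holds, and for
    fixed \<open>g\<close> two indices differ under \<open>d\<close> exactly when they differ under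
    \<open>c\<close>.\<close>
  define d where "d k g \<longleftrightarrow> (c k g = c (\<iota> g) g)" for k g
  define \<zeta> :: "'a set \<Rightarrow> nat" where
    \<comment> \<open>The existential admits both orientations of the edge; an edge satisfying the
      condition in neither gets 2 by default.\<close>
    "\<zeta> e = (if \<exists>u v. u \<in> carrier G \<and> v \<in> carrier G \<and> e = {u, v} \<and> v \<in> ?C (\<iota> u) \<and> d (\<iota> u) v
       then 1 else 2)" for e
  have zeta: "\<zeta> {u, v} = 1 \<longleftrightarrow> d (\<iota> u) v"
    if uv: "u \<in> carrier G" "v \<in> carrier G" "v \<in> ?C (\<iota> u)" for u v
  proof -
    \<comment> \<open>If both orientations apply, minimality of \<open>\<iota>\<close> makes the
      indices equal, and the colour is 1 by normalisation.\<close>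
    have "d (\<iota> u) v" if "u \<in> ?C (\<iota> v)"
    proof -
      have "\<iota> u = \<iota> v"
        using iota_le iota uv that by (meson order_antisym)
      then show ?thesis unfolding d_def by simp
    qed
    then show ?thesis using uv unfolding \<zeta>_def by (auto simp: doubleton_eq_iff)
  qed
  have path: "\<exists>p. graph_path (carrier G) edges y p z \<and> distinct (map \<zeta> (path_edges p))"
    if yz: "y \<in> carrier G" "z \<in> carrier G" "y \<noteq> z" for y z
  proof (cases "{y, z} \<in> edges")
    case True
    then show ?thesis using graph_path_edge[OF yz] by blast
  next
    case False
    define g where "g = (if \<iota> y < \<iota> z then h (\<iota> y) (\<iota> z) else h (\<iota> z) (\<iota> y))"
    \<comment> \<open>Equal indices would put \<open>y\<close> and \<open>z\<close> into one cyclic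
      subgroup and make them adjacent.\<close>
    have ne: "\<iota> y \<noteq> \<iota> z"
      using False yz iota xM unfolding edge_iff by metis
    have r: "1 \<le> \<iota> y" "\<iota> y \<le> card M" "1 \<le> \<iota> z" "\<iota> z \<le> card M"
      using iota yz by auto
    have g: "g \<in> ?C (\<iota> y)" "g \<in> ?C (\<iota> z)" "c (\<iota> y) g \<noteq> c (\<iota> z) g"
      using ne r hC[of "\<iota> y" "\<iota> z"] hC[of "\<iota> z" "\<iota> y"] c[of "\<iota> y" "\<iota> z"] c[of "\<iota> z" "\<iota> y"]
      unfolding g_def by auto
    have M': "x (\<iota> y) \<in> M" "x (\<iota> z) \<in> M" using xM iota yz by auto
    have gc: "g \<in> carrier G" using g M' M_carrier generate_carrier by blast
    have gy: "g \<noteq> y" and gz: "g \<noteq> z" using False g M' iota yz unfolding edge_iff by blast+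
    have E: "{y, g} \<in> edges" "{g, z} \<in> edges"
      using g gy gz M' iota yz unfolding edge_iff by blast+
    have "(\<zeta> {y, g} = 1) \<noteq> (\<zeta> {g, z} = 1)"
      using zeta[OF yz(1) gc g(1)] zeta[OF yz(2) gc g(2)] g(3) unfolding d_def
      by (auto simp: insert_commute)
    then have "\<zeta> {y, g} \<noteq> \<zeta> {g, z}" by auto
    then show ?thesis using graph_path_two_edges[of y "carrier G" g z] yz gc gy gz E by blast
  qed
  have "rainbow_colouring (carrier G) edges 2 \<zeta>"
    unfolding rainbow_colouring_def using path by (auto simp: \<zeta>_def)
  then show ?thesis by blast
qed

section \<open>Bounds and exact value when the independence cyclic set is empty\<close>

context
  assumes ics_empty: "ics G M = {}"
begin

lemma two_maximal_cyclic:
  obtains x y where "x \<in> M" "y \<in> M" "x \<noteq> y"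
proof -
  obtain x where x: "x \<in> M" using in_some_generate[OF one_closed] .
  then have "x \<notin> ics G M" using ics_empty by simp
  then obtain y where "y \<in> M" "y \<noteq> x" using x unfolding ics_def by auto
  then show ?thesis using that x by simp
qed

lemma not_cyclic: "\<not> cyclic_group G"
proof
  assume "cyclic_group G"
  then obtain z where z: "z \<in> carrier G" "subgroup_generated G {z} = G"
    unfolding cyclic_group_def by blast
  then have "generate G {z} = carrier G"
    using carrier_subgroup_generated[of G "{z}"] by simp
  moreover obtain x y where "x \<in> M" "y \<in> M" "x \<noteq> y" by (rule two_maximal_cyclic)
  ultimately show False
    using M_generate_maximal[of x z] M_generate_eq[of y x] z M_carrier by blast
qed

lemma rainbow_colouring_ge_2:
  assumes "rainbow_colouring (carrier G) edges k \<zeta>"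
  shows "2 \<le> k"
proof -
  obtain x y where "x \<in> M" "y \<in> M" "x \<noteq> y" by (rule two_maximal_cyclic)
  then show ?thesis
    using rainbow_two_colouring_midpoint[OF assms, of x y] M_carrier M_not_edge
    by (metis linear order_refl)
qed

text \<open>If \<open>y\<close> is not itself the chosen generator \<open>x\<close>, then
  \<open>x\<close> is the neighbour; if it is, a nontrivial element shared with another maximal
  cyclic subgroup works.\<close>

lemma ex_nontrivial_neighbour:
  assumes "y \<in> carrier G" "y \<noteq> \<one>"
  shows "\<exists>h\<in>carrier G - {\<one>}. h \<noteq> y \<and> {y, h} \<in> edges"
proof -
  obtain x where x: "x \<in> M" "y \<in> generate G {x}" using in_some_generate[OF assms(1)] .
  then obtain z where z: "z \<in> M" "z \<noteq> x" "generate G {x} \<inter> generate G {z} \<noteq> {\<one>}"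
    using ics_empty unfolding ics_def by blast
  moreover have "\<one> \<in> generate G {x} \<inter> generate G {z}" by (simp add: generate.one)
  ultimately obtain w where w: "w \<in> generate G {x}" "w \<in> generate G {z}" "w \<noteq> \<one>" by blast
  have "w \<noteq> x" using M_generate_eq x z w by blast
  have "x \<noteq> \<one>" using M_generate_eq[of x z] x z generate.one[of G "{z}"] by blast
  show ?thesis
  proof (cases "y = x")
    case True
    then show ?thesis
      using x w \<open>w \<noteq> x\<close> M_carrier generate_carrier edge_M_iff by (metis DiffI singletonD)
  next
    case False
    then have "{y, x} \<in> edges" using x edge_M_iff[of x y] by (simp add: insert_commute)
    then show ?thesis using x \<open>x \<noteq> \<one>\<close> False M_carrier by (intro bexI[of _ x]) auto
  qed
qed

lemma rainbow_colouring_3: "\<exists>\<zeta>. rainbow_colouring (carrier G) edges 3 \<zeta>"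
proof -
  have "\<exists>I\<subseteq>carrier G - {\<one>}. \<forall>v\<in>carrier G - {\<one>}. \<exists>u\<in>carrier G - {\<one>}.
      {v, u} \<in> edges \<and> (u \<in> I) \<noteq> (v \<in> I)"
    by (rule ex_opposite_classes)
      (use finite_carrier ex_nontrivial_neighbour in \<open>auto simp: insert_commute\<close>)
  then obtain I where I: "I \<subseteq> carrier G - {\<one>}"
    and nbr: "\<And>v. v \<in> carrier G - {\<one>} \<Longrightarrow>
      \<exists>u\<in>carrier G - {\<one>}. {v, u} \<in> edges \<and> (u \<in> I) \<noteq> (v \<in> I)"
    by blast
  define \<zeta> :: "'a set \<Rightarrow> nat" where
    "\<zeta> e = (if \<one> \<in> e then if e \<inter> I \<noteq> {} then 1 else 2 else 3)" for e
  have path: "\<exists>p. graph_path (carrier G) edges y p z \<and> distinct (map \<zeta> (path_edges p))"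
    if yz: "y \<in> carrier G" "z \<in> carrier G" "y \<noteq> z" for y z
  proof (cases "{y, z} \<in> edges")
    case True
    then show ?thesis using graph_path_edge[OF yz] by blast
  next
    case False
    then have n1: "y \<noteq> \<one>" "z \<noteq> \<one>" using one_edge yz by (auto simp: insert_commute)
    have E: "{y, \<one>} \<in> edges" "{\<one>, z} \<in> edges"
      using one_edge n1 yz by (auto simp: insert_commute)
    \<comment> \<open>Hence \<open>e \<inter> I\<close> reveals the class of the other endpoint of
      an edge at \<open>\<one>\<close>.\<close>
    have "\<one> \<notin> I" using I by blast
    show ?thesis
    proof (cases "(y \<in> I) = (z \<in> I)")
      case False
      then have "\<zeta> {y, \<one>} \<noteq> \<zeta> {\<one>, z}" using \<open>\<one> \<notin> I\<close> unfolding \<zeta>_def by auto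
      then show ?thesis using graph_path_two_edges[of y "carrier G" \<one> z] yz n1 E by auto
    next
      case True
      \<comment> \<open>The classes of \<open>g\<close> and \<open>z\<close> are opposite, so their
        edges to \<open>\<one>\<close> use colours 1 and 2, while \<open>{y, g}\<close> has colour
        3.\<close>
      obtain g where g: "g \<in> carrier G" "g \<noteq> \<one>" "{y, g} \<in> edges" "(g \<in> I) \<noteq> (y \<in> I)"
        using nbr[of y] yz n1 by blast
      have ne: "g \<noteq> z" "g \<noteq> y" using g False by auto
      have E': "{g, \<one>} \<in> edges" using one_edge g by (auto simp: insert_commute)
      show ?thesis
        by (rule exI[of _ "[y, g, \<one>, z]"])
          (use yz n1 E E' g ne True \<open>\<one> \<notin> I\<close> in \<open>auto simp: graph_path_def \<zeta>_def\<close>)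
    qed
  qed
  have "rainbow_colouring (carrier G) edges 3 \<zeta>"
    unfolding rainbow_colouring_def using path by (auto simp: \<zeta>_def)
  then show ?thesis by blast
qed

lemma rc_eq: "rc (carrier G) edges = (if has_awning G M then 2 else 3)"
proof (cases "has_awning G M")
  case True
  then have "rc (carrier G) edges = 2"
    unfolding rc_def using awning_rainbow_colouring rainbow_colouring_ge_2
    by (intro Least_equality) blast+
  then show ?thesis using True by simp
next
  case False
  have "3 \<le> k" if "\<exists>\<zeta>. rainbow_colouring (carrier G) edges k \<zeta>" for k
  proof -
    have "2 \<le> k" "k \<noteq> 2" using that rainbow_colouring_ge_2 rainbow_colouring_awning False by blast+
    then show ?thesis by simp
  qed
  then have "rc (carrier G) edges = 3"
    unfolding rc_def using rainbow_colouring_3 by (intro Least_equality)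
  then show ?thesis using False by simp
qed

end

end

theorem theorem3p6:
  fixes G :: "('a, 'b) monoid_scheme" and M :: "'a set"
  assumes "group G"
    and "finite (carrier G)"
    and "essential_cyclic_set G M"
    and "icn G M = 0"
  shows "(rc (carrier G) (enhanced_power_edges G) = 1 \<longleftrightarrow> cyclic_group G) \<and>
    (rc (carrier G) (enhanced_power_edges G) = 2 \<longleftrightarrow> has_awning G M \<and> \<not> cyclic_group G) \<and>
    (rc (carrier G) (enhanced_power_edges G) = 3 \<longleftrightarrow> \<not> has_awning G M)"
proof -
  interpret group G by (rule assms(1))
  interpret essential_cyclic G M by unfold_locales (rule assms(2), rule assms(3))
  \<comment> \<open>Cardinality 0 means emptiness only for finite sets, as \<open>card\<close> is 0
    on infinite ones.\<close>
  have "finite (ics G M)" using finite_M unfolding ics_def by simp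
  then have "ics G M = {}" using assms(4) unfolding icn_def by simp
  then show ?thesis using rc_eq not_cyclic by simp
qed

end
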